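(* Let $1\le k\le n$, $\mu>0$ and let $q$ be a prime power. If an $(n,k)$ MDS code over $\mathbb{F}_q$ exists, then, used in a coded distributed computing system with $n$ servers and straggling parameter $\mu$, it achieves the minimum average execution time that can be attained by any $(n,k)$ linear code.
   Context: System model. A computational job is divided equally into $k$ tasks, encoded by an $(n,k)$ linear code into $n$ encoded tasks, and the $j$-th encoded task is assigned to the $j$-th of $n$ servers. The run times $T_1,\dots,T_n$ of the servers are i.i.d. with shifted-exponential distribution $\Pr(T_i\le t)=1-\exp(-\mu(kt-1))$ for $t\ge 1/k$, and $\Pr(T_i\le t)=0$ for $t<1/k$. An encoded task not completed by time $t$ is regarded as erased. Decodability. A code together with its decoder over erasure channels determines which sets $S\subseteq\{1,\dots,n\}$ of unerased encoded symbols are decodable. A set of fewer than $k$ unerased symbols is never decodable, and any set containing a decodable set is decodable. The total job completion time $T$ is the first time $t$ at which $\{i:T_i\le t\}$ is decodable ($T=\infty$ if this never happens), and the average execution time is $T_{\rm avg}=\mathbb{E}[T]$. An $(n,k)$ MDS code is an $(n,k)$ linear code with minimum distance $d_{\min}=n-k+1$; it is used with a decoder that recovers any pattern of up to $d_{\min}-1=n-k$ erasures (optimal erasure decoding, for which $S$ is decodable if and only if the columns of the generator matrix indexed by $S$ form a matrix of rank $k$). The comparison is with any $(n,k)$ linear code with any decoder over erasure channels for which no set of fewer than $k$ unerased symbols is decodable and any set containing a decodable set is decodable. *)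

theory Defs
  imports "HOL-Probability.Probability" "HOL-Number_Theory.Prime_Powers"
begin

text \<open>
  The index type \<open>'k\<close> numbers the tasks (message symbols) and \<open>'n\<close> the servers (code symbols).
  A linear code is given by its generator matrix, with \<open>CARD('k)\<close> rows and \<open>CARD('n)\<close> columns;
  messages are row vectors, so that encoding is \<open>m v* G\<close>.
\<close>

definition linear_code :: "('a::{field,finite})^'n^'k \<Rightarrow> bool" where
  "linear_code G \<longleftrightarrow> rank G = CARD('k)"

definition codewords :: "('a::{field,finite})^'n^'k \<Rightarrow> ('a^'n) set" where
  "codewords G = range (\<lambda>m. m v* G)"

definition hamming_dist :: "'a^'n \<Rightarrow> 'a^'n \<Rightarrow> nat" where
  "hamming_dist x y = card {j. x $ j \<noteq> y $ j}"

definition min_dist :: "('a::{field,finite})^'n^'k \<Rightarrow> nat" where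
  "min_dist G = Min {hamming_dist x y | x y. x \<in> codewords G \<and> y \<in> codewords G \<and> x \<noteq> y}"

definition mds_code :: "('a::{field,finite})^'n^'k \<Rightarrow> bool" where
  "mds_code G \<longleftrightarrow> linear_code G \<and> min_dist G = CARD('n) - CARD('k) + 1"

text \<open>The channel output when exactly the symbols in \<open>S\<close> are unerased; \<open>None\<close> is an erasure.\<close>

definition received :: "'n set \<Rightarrow> 'a^'n \<Rightarrow> 'n \<Rightarrow> 'a option" where
  "received S x = (\<lambda>j. if j \<in> S then Some (x $ j) else None)"

text \<open>
  A decoder is an arbitrary function on channel outputs; the result \<open>None\<close> is a decoding failure.
  A set of unerased positions is decodable if every message is recovered from these positions.
\<close>

type_synonym ('a, 'n, 'k) decoder = "('n \<Rightarrow> 'a option) \<Rightarrow> ('a^'k) option"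

definition decodable ::
    "('a::{field,finite})^'n^'k \<Rightarrow> ('a, 'n, 'k) decoder \<Rightarrow> 'n set \<Rightarrow> bool" where
  "decodable G D S \<longleftrightarrow> (\<forall>m. D (received S (m v* G)) = Some m)"

definition admissible_decoder ::
    "('a::{field,finite})^'n^'k \<Rightarrow> ('a, 'n, 'k) decoder \<Rightarrow> bool" where
  "admissible_decoder G D \<longleftrightarrow>
     (\<forall>S. card S < CARD('k) \<longrightarrow> \<not> decodable G D S) \<and>
     (\<forall>S S'. decodable G D S \<and> S \<subseteq> S' \<longrightarrow> decodable G D S')"

definition recovers_erasures ::
    "('a::{field,finite})^'n^'k \<Rightarrow> ('a, 'n, 'k) decoder \<Rightarrow> nat \<Rightarrow> bool" where
  "recovers_erasures G D e \<longleftrightarrow> (\<forall>S. card (- S) \<le> e \<longrightarrow> decodable G D S)"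

definition (in prob_space) iid_run_times ::
    "nat \<Rightarrow> real \<Rightarrow> ('n::finite \<Rightarrow> 'a \<Rightarrow> real) \<Rightarrow> bool" where
  "iid_run_times k \<mu> T \<longleftrightarrow>
     indep_vars (\<lambda>_. borel) T UNIV \<and>
     (\<forall>j t. prob {\<omega> \<in> space M. T j \<omega> \<le> t} =
            (if t \<ge> 1 / real k then 1 - exp (- \<mu> * (real k * t - 1)) else 0))"

text \<open>If no time makes the set of finished servers decodable, the infimum is \<open>\<infinity>\<close>.\<close>

definition completion_time ::
    "('a::{field,finite})^'n^'k \<Rightarrow> ('a, 'n, 'k) decoder \<Rightarrow> ('n \<Rightarrow> real) \<Rightarrow> ennreal" where
  "completion_time G D \<tau> = (INF t \<in> {t. t \<ge> 0 \<and> decodable G D {j. \<tau> j \<le> t}}. ennreal t)"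

definition avg_time ::
    "'w measure \<Rightarrow> ('n \<Rightarrow> 'w \<Rightarrow> real) \<Rightarrow> ('a::{field,finite})^'n^'k \<Rightarrow> ('a, 'n, 'k) decoder \<Rightarrow> ennreal"
  where "avg_time M T G D = (\<integral>\<^sup>+ \<omega>. completion_time G D (\<lambda>j. T j \<omega>) \<partial>M)"

end

theory Submission
  imports Defs
begin

text \<open>
  For an MDS code, recovering \<open>min_dist G - 1 = n - k\<close> erasures makes every set of at least
  \<open>k\<close> positions decodable, and no admissible decoder of any code decodes from fewer. So the MDS
  code is decodable whenever a competitor is, and its completion time is the smaller one for every
  realisation of the run times.
\<close>

text \<open>A basis of the row space chosen among the rows has CARD('k) elements, and there are at
  most that many distinct rows. So no row repeats and the basis is the whole set
  \<open>rows G\<close>.\<close>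

lemma full_row_rank_independent:
  fixes G :: "'a::field^'n^'k"
  assumes "rank G = CARD('k)"
  shows "inj (\<lambda>i. row i G)" and "vec.independent (rows G)"
proof -
  have rows: "rows G = range (\<lambda>i. row i G)"
    by (auto simp: rows_def)
  then have fin: "finite (rows G)" and "card (rows G) \<le> CARD('k)"
    by (auto intro: card_image_le)
  obtain B where B: "B \<subseteq> rows G" "vec.independent B" "card B = vec.dim (rows G)"
    using vec.basis_exists by metis
  then have card_B: "card B = CARD('k)"
    using assms by (simp add: row_rank_def_gen)
  then have "card (rows G) = CARD('k)"
    using card_mono[OF fin B(1)] \<open>card (rows G) \<le> CARD('k)\<close> by simp
  then show "inj (\<lambda>i. row i G)"
    unfolding rows by (intro eq_card_imp_inj_on) auto
  have "B = rows G"
    using fin B(1) card_B \<open>card (rows G) = CARD('k)\<close> by (intro card_subset_eq) auto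
  with B(2) show "vec.independent (rows G)" by simp
qed

lemma vector_matrix_mult_rows:
  fixes G :: "'a::field^'n^'k"
  shows "m v* G = (\<Sum>i\<in>UNIV. m $ i *s row i G)"
  by (simp add: vec_eq_iff vector_matrix_mult_def row_def mult.commute)

lemma linear_code_inj:
  fixes G :: "('a::{field,finite})^'n^'k"
  assumes "linear_code G"
  shows "inj (\<lambda>m. m v* G)"
proof (rule injI)
  fix x y :: "'a^'k"
  assume eq: "x v* G = y v* G"
  have "rank G = CARD('k)"
    using assms by (simp add: linear_code_def)
  note inj = full_row_rank_independent(1)[OF this] and ind = full_row_rank_independent(2)[OF this]
  \<comment> \<open>\<open>vec.independent\<close> concerns a set of vectors, so coefficients must
    be indexed by the rows themselves; injectivity of \<open>row\<close> makes this reindexing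
    possible.\<close>
  define c where "c v = x $ inv (\<lambda>i. row i G) v - y $ inv (\<lambda>i. row i G) v" for v
  have c: "c (row i G) = x $ i - y $ i" for i
    using inv_f_f[OF inj, of i] by (simp add: c_def)
  have rows: "rows G = range (\<lambda>i. row i G)"
    by (auto simp: rows_def)
  have "(\<Sum>v\<in>rows G. c v *s v) = (\<Sum>i\<in>UNIV. (x $ i - y $ i) *s row i G)"
    unfolding rows by (simp add: sum.reindex[OF inj] c)
  also have "\<dots> = x v* G - y v* G"
    by (simp add: vector_matrix_mult_rows vec.scale_left_diff_distrib sum_subtractf)
  finally have "(\<Sum>v\<in>rows G. c v *s v) = 0"
    using eq by simp
  then have "c (row i G) = 0" for i
    using vec.independentD[OF ind _ subset_refl, of c "row i G"] by (auto simp: rows)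
  then show "x = y"
    by (simp add: c vec_eq_iff)
qed

lemma min_dist_le:
  assumes "x \<in> codewords G" "y \<in> codewords G" "x \<noteq> y"
  shows "min_dist G \<le> hamming_dist x y"
proof -
  have "finite {hamming_dist x y | x y. x \<in> codewords G \<and> y \<in> codewords G \<and> x \<noteq> y}"
    by (rule finite_subset[of _ "\<Union>x. range (hamming_dist x)"]) auto
  then show ?thesis
    unfolding min_dist_def using assms by (intro Min_le) auto
qed

text \<open>Erasures are visible as \<open>None\<close>, so the output alone reveals which positions
  survived.\<close>

lemma received_eq_iff:
  "received S x = received S' y \<longleftrightarrow> S = S' \<and> (\<forall>j\<in>S. x $ j = y $ j)"
  unfolding received_def fun_eq_iff by (auto split: if_splits)

text \<open>Codewords that agree on \<open>S\<close> can differ only on the erased positions, which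
  are too few to separate two distinct codewords.\<close>

lemma received_codeword_inj:
  fixes G :: "('a::{field,finite})^'n^'k"
  assumes lin: "linear_code G" and S: "card (- S) < min_dist G"
    and eq: "received S (m v* G) = received S (m' v* G)"
  shows "m = m'"
proof (rule ccontr)
  assume "m \<noteq> m'"
  then have ne: "m v* G \<noteq> m' v* G"
    using linear_code_inj[OF lin] by (meson injD)
  have "{j. (m v* G) $ j \<noteq> (m' v* G) $ j} \<subseteq> - S"
    using eq by (auto simp: received_eq_iff)
  then have "hamming_dist (m v* G) (m' v* G) \<le> card (- S)"
    unfolding hamming_dist_def by (intro card_mono) auto
  moreover have "min_dist G \<le> hamming_dist (m v* G) (m' v* G)"
    using ne by (intro min_dist_le) (auto simp: codewords_def)
  ultimately show False
    using S by simp
qed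

lemma ex_decoder_recovers_erasures:
  fixes G :: "('a::{field,finite})^'n^'k"
  assumes lin: "linear_code G" and e: "e < min_dist G"
  shows "\<exists>D. recovers_erasures G D e"
proof -
  \<comment> \<open>The decoder picks some message consistent with the output. With at most
    \<open>e\<close> erasures it is unique; on outputs that fit no message the choice is
    arbitrary.\<close>
  define D where
    "D r = Some (SOME m. \<exists>S. card (- S) \<le> e \<and> r = received S (m v* G))" for r
  have "D (received S (m v* G)) = Some m" if S: "card (- S) \<le> e" for S m
  proof -
    have "(SOME m'. \<exists>S'. card (- S') \<le> e \<and> received S (m v* G) = received S' (m' v* G)) = m"
    proof (rule some_equality)
      fix m'
      assume "\<exists>S'. card (- S') \<le> e \<and> received S (m v* G) = received S' (m' v* G)"
      then have "received S (m' v* G) = received S (m v* G)"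
        by (auto simp: received_eq_iff)
      then show "m' = m"
        using received_codeword_inj[OF lin, of S] S e by simp
    qed (use S in blast)
    then show ?thesis by (simp add: D_def)
  qed
  then show ?thesis
    unfolding recovers_erasures_def decodable_def by blast
qed

text \<open>Counting: the channel outputs with unerased set \<open>S\<close> take at most
  \<open>CARD('a) ^ card S\<close> values, too few for all messages when \<open>S\<close> is small.\<close>

lemma decodable_card_ge:
  fixes G :: "('a::{field,finite})^'n^'k"
  assumes "decodable G D S"
  shows "CARD('k) \<le> card S"
proof -
  \<comment> \<open>Restricting fixes the values outside \<open>S\<close> to
    \<open>undefined\<close>, so the range lies in a \<open>PiE\<close> over \<open>S\<close> that
    can be counted.\<close>
  let ?f = "\<lambda>m::'a^'k. restrict (($) (m v* G)) S"
  have "inj ?f"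
  proof (rule injI)
    fix m m' assume "?f m = ?f m'"
    then have "received S (m v* G) = received S (m' v* G)"
      unfolding received_eq_iff by (metis restrict_apply')
    then show "m = m'"
      using assms unfolding decodable_def by (metis option.inject)
  qed
  moreover have "range ?f \<subseteq> PiE S (\<lambda>_. UNIV)"
    by (auto simp: PiE_def)
  ultimately have "CARD('a^'k) \<le> card (PiE S (\<lambda>_. UNIV :: 'a set))"
    by (intro card_inj_on_le) (auto intro: finite_PiE)
  then have "CARD('a) ^ CARD('k) \<le> CARD('a) ^ card S"
    by (simp add: card_PiE)
  \<comment> \<open>Exponents can be compared because the base exceeds 1: a field has 0 and 1
    distinct.\<close>
  moreover have "1 < CARD('a)"
  proof -
    have "card {0, 1 :: 'a} \<le> CARD('a)"
      by (rule card_mono) auto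
    then show ?thesis by simp
  qed
  ultimately show ?thesis
    by (rule power_le_imp_le_exp[rotated])
qed

lemma mds_recovers_erasures_decodable_iff:
  fixes G :: "('a::{field,finite})^'n^'k"
  assumes "mds_code G" and "recovers_erasures G D (min_dist G - 1)"
  shows "decodable G D S \<longleftrightarrow> CARD('k) \<le> card S"
proof
  assume "CARD('k) \<le> card S"
  then have "card (- S) \<le> min_dist G - 1"
    using assms(1) card_Diff_subset[of S UNIV]
    by (simp add: mds_code_def flip: Compl_eq_Diff_UNIV)
  then show "decodable G D S"
    using assms(2) by (simp add: recovers_erasures_def)
qed (rule decodable_card_ge)

theorem corollary5:
  fixes n k q :: nat and \<mu> :: real
    and M :: "'w measure" and T :: "'n::finite \<Rightarrow> 'w \<Rightarrow> real"
    and G :: "('a::{field,finite})^'n^('k::finite)"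
  assumes "CARD('n) = n" and "CARD('k) = k" and "1 \<le> k" and "k \<le> n"
    and "\<mu> > 0"
    and "primepow q" and "CARD('a) = q"
    and "prob_space M" and "prob_space.iid_run_times M k \<mu> T"
    and "mds_code G"
  shows "(\<exists>D. recovers_erasures G D (min_dist G - 1)) \<and>
    (\<forall>D. recovers_erasures G D (min_dist G - 1) \<longrightarrow>
       linear_code G \<and> admissible_decoder G D \<and>
       (\<forall>(G' :: ('b::{field,finite})^'n^'k) D'.
          linear_code G' \<and> admissible_decoder G' D' \<longrightarrow>
          avg_time M T G D \<le> avg_time M T G' D'))"
proof (intro conjI allI impI)
  \<comment> \<open>Positivity guards against truncated subtraction: it gives
    \<open>min_dist G - 1 < min_dist G\<close>.\<close>
  have lin: "linear_code G" and d: "0 < min_dist G"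
    using \<open>mds_code G\<close> by (auto simp: mds_code_def)
  show "\<exists>D. recovers_erasures G D (min_dist G - 1)"
    using ex_decoder_recovers_erasures[OF lin] d by simp
  fix D assume "recovers_erasures G D (min_dist G - 1)"
  note dec = mds_recovers_erasures_decodable_iff[OF \<open>mds_code G\<close> this]
  show "linear_code G" by (fact lin)
  show "admissible_decoder G D"
    unfolding admissible_decoder_def dec
    using card_mono[OF finite] by (metis not_le order.trans)
  fix G' :: "'b^'n^'k" and D'
  assume "linear_code G' \<and> admissible_decoder G' D'"
  then have "decodable G D S" if "decodable G' D' S" for S
    using that unfolding dec admissible_decoder_def by (meson not_le)
  \<comment> \<open>For each outcome, the times at which the competitor can decode are among those
    at which \<open>D\<close> can, and an infimum over more times is no larger.\<close>
  then show "avg_time M T G D \<le> avg_time M T G' D'"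
    unfolding avg_time_def completion_time_def
    by (intro nn_integral_mono INF_superset_mono) auto
qed

end
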